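(* Let $a$ and $b$ be positive integers with $b\geq\max\{a,3\}$, and let $G$ be a graph of order $n$ with $n\geq\max\{a+2,7\}$. If the minimum degree satisfies $\delta(G)\geq a+1$ and the number of edges satisfies $$e(G)\geq\binom{n-1}{2}+\frac{a+2}{2},$$ then $G$ is a fractional $[a,b]$-deleted graph.
   Context: All graphs are finite, undirected, without loops or multiple edges. For a graph $G$ and vertex $v$, $E_G(v)$ denotes the set of edges incident with $v$. For positive integers $a\leq b$, a fractional $[a,b]$-factor of $G$ is given by a function $h:E(G)\to[0,1]$ such that $a\leq\sum_{e\in E_G(v)}h(e)\leq b$ for every $v\in V(G)$ (the factor being the spanning subgraph with edge set $\{e: h(e)>0\}$). $G$ is called a fractional $[a,b]$-deleted graph if for every edge $e\in E(G)$, the graph $G-e$ has a fractional $[a,b]$-factor. $e(G)$ denotes the number of edges of $G$ and $\delta(G)$ its minimum degree. *)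

theory Defs
  imports Complex_Main "HOL-Library.Ramsey"
begin

text \<open>A finite simple graph is given by its vertex set \<open>V\<close> and its set \<open>E\<close> of edges, an edge being
  a two-element subset of \<open>V\<close>.\<close>

definition simple_graph :: "'a set \<Rightarrow> 'a set set \<Rightarrow> bool" where
  "simple_graph V E \<longleftrightarrow> finite V \<and> E \<subseteq> nsets V 2"

definition incident_edges :: "'a set set \<Rightarrow> 'a \<Rightarrow> 'a set set" where
  "incident_edges E v = {e \<in> E. v \<in> e}"

definition degree :: "'a set set \<Rightarrow> 'a \<Rightarrow> nat" where
  "degree E v = card (incident_edges E v)"

text \<open>Meaningful only for finite nonempty \<open>V\<close>.\<close>

definition min_degree :: "'a set \<Rightarrow> 'a set set \<Rightarrow> nat" where
  "min_degree V E = Min (degree E ` V)"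

text \<open>\<open>F\<close> is the edge set of the factor, which is a spanning subgraph, so its vertex set is \<open>V\<close>.
  The values of \<open>h\<close> outside \<open>E\<close> are irrelevant.\<close>

definition fractional_factor ::
    "nat \<Rightarrow> nat \<Rightarrow> 'a set \<Rightarrow> 'a set set \<Rightarrow> 'a set set \<Rightarrow> bool" where
  "fractional_factor a b V E F \<longleftrightarrow>
     (\<exists>h :: 'a set \<Rightarrow> real.
        (\<forall>e\<in>E. 0 \<le> h e \<and> h e \<le> 1) \<and>
        (\<forall>v\<in>V. real a \<le> (\<Sum>e\<in>incident_edges E v. h e) \<and>
                (\<Sum>e\<in>incident_edges E v. h e) \<le> real b) \<and>
        F = {e \<in> E. h e > 0})"

definition fractional_deleted_graph :: "nat \<Rightarrow> nat \<Rightarrow> 'a set \<Rightarrow> 'a set set \<Rightarrow> bool" where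
  "fractional_deleted_graph a b V E \<longleftrightarrow> (\<forall>e\<in>E. \<exists>F. fractional_factor a b V (E - {e}) F)"

end

theory Submission
  imports Defs "HOL-Analysis.Function_Topology"
begin

text \<open>Sufficiency in Anstee's criterion for fractional \<open>[a,b]\<close>-factors is obtained by minimising, over
  all \<open>h : E \<rightarrow> [0,1]\<close>, the sum of the squared distances of the weighted degrees to \<open>[a,b]\<close>. Let
  \<open>y v\<close> be the signed defect of \<open>v\<close> at a minimiser and suppose that \<open>c = max \<bar>y\<bar> > 0\<close>. By first-order
  optimality, with \<open>T = {y = c}\<close> and \<open>S = {y = -c}\<close>, every edge meeting \<open>T\<close> but not \<open>S\<close> has weight \<open>1\<close>
  and every edge meeting \<open>S\<close> but not \<open>T\<close> has weight \<open>0\<close>, so that summing weighted degrees over \<open>T\<close>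
  and \<open>S\<close> shows that the pair \<open>S, T\<close> violates the criterion.

  For the theorem, let \<open>S, T\<close> violate the criterion in \<open>G - e\<close>. The degree condition forces
  \<open>\<bar>S\<bar> \<ge> 2\<close> and \<open>\<bar>T\<bar> > b\<close>, and then the non-edges at \<open>T\<close> outnumber what the edge condition allows.\<close>

section \<open>Distance to \<open>[a,b]\<close> and incidence counting\<close>

text \<open>For \<open>a <= b\<close>, minus twice this value is the derivative of the squared
  distance from \<open>d\<close> to \<open>[a,b]\<close>; a positive defect asks for more
  weight.\<close>

definition defect :: "real \<Rightarrow> real \<Rightarrow> real \<Rightarrow> real" where
  "defect a b d = max a (min b d) - d"

text \<open>The shifted point is compared with the projection of the original point to \<open>[a,b]\<close>.\<close>

lemma defect_shift_le:
  assumes "a \<le> b"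
  shows "(defect a b (d + \<epsilon>))\<^sup>2 \<le> (defect a b d)\<^sup>2 - 2 * \<epsilon> * defect a b d + \<epsilon>\<^sup>2"
proof -
  have "\<bar>defect a b (d + \<epsilon>)\<bar> \<le> \<bar>defect a b d - \<epsilon>\<bar>"
    using assms unfolding defect_def by (simp add: max_def min_def abs_if)
  then have "(defect a b (d + \<epsilon>))\<^sup>2 \<le> (defect a b d - \<epsilon>)\<^sup>2"
    by (simp add: abs_le_square_iff)
  then show ?thesis
    by (simp add: power2_diff algebra_simps)
qed

text \<open>Handshake double counting restricted to \<open>T\<close>: an edge is met once for each
  of its ends in \<open>T\<close>. The semiring is general to cover the weight \<open>h\<close> as
  well as plain counts in \<open>nat\<close> and \<open>real\<close>.\<close>

lemma sum_incident_edges_swap: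
  fixes f :: "'a set \<Rightarrow> 'b::comm_semiring_1"
  assumes "finite T" "finite E"
  shows "(\<Sum>v\<in>T. \<Sum>e\<in>incident_edges E v. f e) = (\<Sum>e\<in>E. of_nat (card (e \<inter> T)) * f e)"
proof -
  have "(\<Sum>v\<in>T. \<Sum>e\<in>incident_edges E v. f e) = (\<Sum>v\<in>T. \<Sum>e\<in>E. if v \<in> e then f e else 0)"
    unfolding incident_edges_def using assms by (simp add: sum.inter_filter)
  also have "\<dots> = (\<Sum>e\<in>E. \<Sum>v\<in>T. if v \<in> e then f e else 0)"
    by (rule sum.swap)
  also have "\<dots> = (\<Sum>e\<in>E. of_nat (card (e \<inter> T)) * f e)"
  proof (rule sum.cong[OF refl])
    fix e assume "e \<in> E"
    have "(\<Sum>v\<in>T. if v \<in> e then f e else 0) = (\<Sum>v\<in>{v \<in> T. v \<in> e}. f e)"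
      using assms by (intro sum.inter_filter[symmetric]) auto
    moreover have "{v \<in> T. v \<in> e} = e \<inter> T" by auto
    ultimately show "(\<Sum>v\<in>T. if v \<in> e then f e else 0) = of_nat (card (e \<inter> T)) * f e"
      by simp
  qed
  finally show ?thesis .
qed

lemma simple_graph_finite_edges:
  assumes "simple_graph V E"
  shows "finite E"
  using assms finite_subset finite_imp_finite_nsets unfolding simple_graph_def by blast

lemma simple_graph_edgeE:
  assumes "simple_graph V E" "e \<in> E"
  obtains u v where "e = {u, v}" "u \<noteq> v" "u \<in> V" "v \<in> V"
proof -
  have "e \<subseteq> V" "card e = 2"
    using assms unfolding simple_graph_def nsets_def by auto
  then show thesis
    using that by (auto simp: card_2_iff)
qed

lemma sum_degree_le:
  assumes "simple_graph V E" "finite T"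
  shows "(\<Sum>v\<in>T. degree E v) \<le> 2 * card E"
proof -
  have fin: "finite E" using assms simple_graph_finite_edges by blast
  have "(\<Sum>v\<in>T. degree E v) = (\<Sum>v\<in>T. \<Sum>e\<in>incident_edges E v. 1)"
    by (simp add: degree_def)
  also have "\<dots> = (\<Sum>e\<in>E. card (e \<inter> T))"
    using sum_incident_edges_swap[OF assms(2) fin, of "\<lambda>_. 1::nat"] by simp
  also have "\<dots> \<le> (\<Sum>e\<in>E. 2)"
  proof (rule sum_mono)
    fix e assume "e \<in> E"
    then have "finite e" "card e = 2"
      using assms unfolding simple_graph_def nsets_def by auto
    then show "card (e \<inter> T) \<le> 2"
      by (metis card_mono inf_le1)
  qed
  finally show ?thesis by simp
qed

section \<open>Minimising the total squared defect\<close>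

definition total_defect :: "real \<Rightarrow> real \<Rightarrow> 'a set \<Rightarrow> 'a set set \<Rightarrow> ('a set \<Rightarrow> real) \<Rightarrow> real" where
  "total_defect a b V E h = (\<Sum>v\<in>V. (defect a b (\<Sum>e\<in>incident_edges E v. h e))\<^sup>2)"

text \<open>Weights are functions on all of \<open>'a set\<close>. Those with values in
  \<open>[0,1]\<close> form a cube, compact by Tychonoff, and the objective is continuous because it
  is built from coordinate projections.\<close>

lemma total_defect_attains_min:
  obtains h :: "'a set \<Rightarrow> real"
    where "\<And>e. 0 \<le> h e" "\<And>e. h e \<le> 1"
      "\<And>g. (\<And>e. 0 \<le> g e \<and> g e \<le> 1) \<Longrightarrow> total_defect a b V E h \<le> total_defect a b V E g"
proof -
  define K :: "('a set \<Rightarrow> real) set" where "K = PiE UNIV (\<lambda>_. {0..1})"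
  have "compactin (product_topology (\<lambda>_. euclidean) UNIV) K"
    unfolding K_def by (subst compactin_PiE) auto
  then have "compact K"
    by (simp only: euclidean_product_topology compactin_euclidean_iff)
  moreover have "K \<noteq> {}"
    unfolding K_def by (simp add: PiE_eq_empty_iff)
  moreover have "continuous_on K (total_defect a b V E)"
    unfolding total_defect_def defect_def
    by (intro continuous_intros continuous_on_product_coordinates
        continuous_on_subset[OF continuous_on_product_coordinates subset_UNIV])
  ultimately obtain h where "h \<in> K" "\<forall>g\<in>K. total_defect a b V E h \<le> total_defect a b V E g"
    using continuous_attains_inf by blast
  then show thesis
    by (intro that[of h]) (auto simp: K_def PiE_iff)
qed

text \<open>Only the two ends of the edge change their weighted degree. This upper bound stands in
  for the derivative in the direction of one edge, so the clamp need not be differentiated.\<close>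

lemma total_defect_edge_shift:
  fixes h :: "'a set \<Rightarrow> real"
  assumes "simple_graph V E" "a \<le> b" "{u, w} \<in> E" "u \<noteq> w"
  defines "y \<equiv> \<lambda>v. defect a b (\<Sum>e\<in>incident_edges E v. h e)"
  shows "total_defect a b V E (h({u, w} := h {u, w} + \<epsilon>))
    \<le> total_defect a b V E h - 2 * \<epsilon> * (y u + y w) + 2 * \<epsilon>\<^sup>2"
proof -
  let ?g = "h({u, w} := h {u, w} + \<epsilon>)"
  have finV: "finite V" using assms(1) by (simp add: simple_graph_def)
  have finE: "finite E" using assms(1) by (rule simple_graph_finite_edges)
  have uwV: "u \<in> V" "w \<in> V"
    using assms(1,3) by (auto simp: simple_graph_def nsets_def)
  have deg: "(\<Sum>e\<in>incident_edges E v. ?g e)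
      = (\<Sum>e\<in>incident_edges E v. h e) + (if v \<in> {u, w} then \<epsilon> else 0)" for v
  proof -
    have "(\<Sum>e\<in>incident_edges E v. ?g e)
        = (\<Sum>e\<in>incident_edges E v. h e + (if e = {u, w} then \<epsilon> else 0))"
      by (intro sum.cong) auto
    also have "\<dots> = (\<Sum>e\<in>incident_edges E v. h e) + (if v \<in> {u, w} then \<epsilon> else 0)"
      using assms(3) finE by (simp add: sum.distrib incident_edges_def)
    finally show ?thesis .
  qed
  have "total_defect a b V E ?g
      \<le> (\<Sum>v\<in>V. (y v)\<^sup>2 + (if v \<in> {u, w} then - 2 * \<epsilon> * y v + \<epsilon>\<^sup>2 else 0))"
    unfolding total_defect_def
  proof (rule sum_mono)
    fix v
    show "(defect a b (\<Sum>e\<in>incident_edges E v. ?g e))\<^sup>2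
      \<le> (y v)\<^sup>2 + (if v \<in> {u, w} then - 2 * \<epsilon> * y v + \<epsilon>\<^sup>2 else 0)"
      unfolding deg y_def
      using defect_shift_le[OF assms(2), of "\<Sum>e\<in>incident_edges E v. h e" \<epsilon>] by auto
  qed
  also have "\<dots> = total_defect a b V E h
      + (\<Sum>v\<in>V. if v \<in> {u, w} then - 2 * \<epsilon> * y v + \<epsilon>\<^sup>2 else 0)"
    by (simp add: sum.distrib total_defect_def y_def)
  also have "(\<Sum>v\<in>V. if v \<in> {u, w} then - 2 * \<epsilon> * y v + \<epsilon>\<^sup>2 else 0)
      = (\<Sum>v\<in>{u, w}. - 2 * \<epsilon> * y v + \<epsilon>\<^sup>2)"
    using finV uwV by (intro sum.mono_neutral_cong_right) auto
  also have "\<dots> = - 2 * \<epsilon> * (y u + y w) + 2 * \<epsilon>\<^sup>2"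
    using assms(4) by (simp add: algebra_simps)
  finally show ?thesis by (simp only: diff_conv_add_uminus mult_minus_left add.assoc)
qed

section \<open>Sufficiency of Anstee's criterion\<close>

lemma fractional_factor_if_anstee:
  fixes V :: "'a set" and a b :: nat
  assumes G: "simple_graph V E" and ab: "a \<le> b"
    and anstee: "\<And>S T. S \<subseteq> V \<Longrightarrow> T \<subseteq> V \<Longrightarrow> S \<inter> T = {} \<Longrightarrow>
      a * card T \<le> b * card S + (\<Sum>v\<in>T. degree {e \<in> E. e \<inter> S = {}} v)"
  shows "\<exists>F. fractional_factor a b V E F"
proof -
  have finV: "finite V" using G by (simp add: simple_graph_def)
  have finE: "finite E" using G by (rule simple_graph_finite_edges)
  have ab': "real a \<le> real b" using ab by simp
  obtain h :: "'a set \<Rightarrow> real" where h: "\<And>e. 0 \<le> h e" "\<And>e. h e \<le> 1"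
    and hmin: "\<And>g. (\<And>e. 0 \<le> g e \<and> g e \<le> 1) \<Longrightarrow>
      total_defect a b V E h \<le> total_defect a b V E g"
    using total_defect_attains_min[of "real a" "real b" V E] by blast
  define d where "d v = (\<Sum>e\<in>incident_edges E v. h e)" for v
  define y where "y v = defect a b (d v)" for v
  have shift: "2 * \<epsilon> * (y u + y w) \<le> 2 * \<epsilon>\<^sup>2"
    if "{u, w} \<in> E" "u \<noteq> w" "0 \<le> h {u, w} + \<epsilon>" "h {u, w} + \<epsilon> \<le> 1" for u w \<epsilon>
  proof -
    have "total_defect a b V E h \<le> total_defect a b V E (h({u, w} := h {u, w} + \<epsilon>))"
      using that h by (intro hmin) auto
    with total_defect_edge_shift[OF G ab' that(1,2), of h \<epsilon>] show ?thesis
      unfolding y_def d_def by simp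
  qed
  have full: "h {u, w} = 1" if e: "{u, w} \<in> E" "u \<noteq> w" and pos: "y u + y w > 0" for u w
  proof (rule ccontr)
    assume "h {u, w} \<noteq> 1"
    then have lt: "h {u, w} < 1" using h(2)[of "{u, w}"] by simp
    \<comment> \<open>The first bound keeps the new weight feasible. As \<open>shift\<close> yields
      \<open>y u + y w <= \<epsilon>\<close> for positive \<open>\<epsilon>\<close>, taking at most
      half of \<open>y u + y w\<close> contradicts minimality.\<close>
    define \<epsilon> where "\<epsilon> = min (1 - h {u, w}) ((y u + y w) / 2)"
    have "\<epsilon> > 0" "\<epsilon> < y u + y w" "h {u, w} + \<epsilon> \<le> 1"
      using lt pos unfolding \<epsilon>_def by (auto simp: min_def field_simps)
    moreover have "0 \<le> h {u, w} + \<epsilon>" using \<open>\<epsilon> > 0\<close> h(1)[of "{u, w}"] by simp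
    ultimately show False
      using shift[OF e, of \<epsilon>] by (simp add: power2_eq_square)
  qed
  have empty: "h {u, w} = 0" if e: "{u, w} \<in> E" "u \<noteq> w" and neg: "y u + y w < 0" for u w
  proof (rule ccontr)
    assume "h {u, w} \<noteq> 0"
    then have lt: "h {u, w} > 0" using h(1)[of "{u, w}"] by simp
    define \<epsilon> where "\<epsilon> = max (- h {u, w}) ((y u + y w) / 2)"
    have "\<epsilon> < 0" "\<epsilon> > y u + y w" "0 \<le> h {u, w} + \<epsilon>"
      using lt neg unfolding \<epsilon>_def by (auto simp: max_def field_simps)
    moreover have "h {u, w} + \<epsilon> \<le> 1" using \<open>\<epsilon> < 0\<close> h(2)[of "{u, w}"] by simp
    ultimately show False
      using shift[OF e, of \<epsilon>] by (simp add: power2_eq_square)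
  qed
  have y0: "y v = 0" if "v \<in> V" for v
  proof (rule ccontr)
    assume "y v \<noteq> 0"
    define c where "c = Max ((\<lambda>v. \<bar>y v\<bar>) ` V)"
    have le_c: "\<bar>y v\<bar> \<le> c" if "v \<in> V" for v
      unfolding c_def using finV that by simp
    have "c > 0" using le_c[OF \<open>v \<in> V\<close>] \<open>y v \<noteq> 0\<close> by simp
    have "c \<in> (\<lambda>v. \<bar>y v\<bar>) ` V"
      unfolding c_def using finV \<open>v \<in> V\<close> by (intro Max_in) auto
    then obtain m where m: "m \<in> V" "\<bar>y m\<bar> = c" by auto
    define T where "T = {v \<in> V. y v = c}"
    define S where "S = {v \<in> V. y v = - c}"
    have ST: "S \<subseteq> V" "T \<subseteq> V" "S \<inter> T = {}"
      using \<open>c > 0\<close> by (auto simp: S_def T_def)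
    have fin: "finite S" "finite T" using ST finV finite_subset by blast+
    have nonempty: "card S + card T > 0"
      using m fin by (auto simp: S_def T_def card_gt_0_iff abs_if split: if_splits)
    have dT: "d v = real a - c" if "v \<in> T" for v
      using that \<open>c > 0\<close> ab' unfolding T_def y_def defect_def
      by (auto simp: max_def min_def split: if_splits)
    have dS: "d v = real b + c" if "v \<in> S" for v
      using that \<open>c > 0\<close> ab' unfolding S_def y_def defect_def
      by (auto simp: max_def min_def split: if_splits)
    \<comment> \<open>Weights turn into counts: an edge with one end in \<open>T\<close> and the
      other in \<open>S\<close> cancels, and every other edge meeting \<open>S\<close> or
      \<open>T\<close> has weight 1 or 0 by \<open>full\<close> and \<open>empty\<close>.\<close>
    have edge: "real (card (e \<inter> T)) * h e - real (card (e \<inter> S)) * h e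
        = (if e \<inter> S = {} then real (card (e \<inter> T)) else 0)" if "e \<in> E" for e
    proof -
      obtain u w where uw: "e = {u, w}" "u \<noteq> w" "u \<in> V" "w \<in> V"
        using simple_graph_edgeE[OF G \<open>e \<in> E\<close>] by blast
      have bounds: "y u \<le> c" "- c \<le> y u" "y w \<le> c" "- c \<le> y w"
        using le_c[OF uw(3)] le_c[OF uw(4)] by auto
      have T1: "h e = 1" if "e \<inter> S = {}" "e \<inter> T \<noteq> {}"
      proof -
        \<comment> \<open>Off \<open>S\<close> both defects exceed \<open>- c\<close>, and at least
          one equals \<open>c\<close>.\<close>
        have "y u + y w > 0"
          using that uw bounds unfolding S_def T_def by auto
        then show ?thesis using full uw \<open>e \<in> E\<close> by simp
      qed
      have S0: "h e = 0" if "e \<inter> S \<noteq> {}" "e \<inter> T = {}"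
      proof -
        have "y u + y w < 0"
          using that uw bounds unfolding S_def T_def by auto
        then show ?thesis using empty uw \<open>e \<in> E\<close> by simp
      qed
      have "card (e \<inter> S) = card (e \<inter> T)" if "e \<inter> S \<noteq> {}" "e \<inter> T \<noteq> {}"
      proof -
        have "(e \<inter> S = {u} \<and> e \<inter> T = {w}) \<or> (e \<inter> S = {w} \<and> e \<inter> T = {u})"
          using that uw ST(3) by auto
        then show ?thesis by auto
      qed
      with T1 S0 show ?thesis
        by (cases "e \<inter> S = {}"; cases "e \<inter> T = {}") auto
    qed
    have "(real a - c) * card T - (real b + c) * card S = (\<Sum>v\<in>T. d v) - (\<Sum>v\<in>S. d v)"
      using dT dS by (simp add: mult.commute)
    also have "\<dots> = (\<Sum>e\<in>E. real (card (e \<inter> T)) * h e - real (card (e \<inter> S)) * h e)"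
      unfolding d_def using fin finE by (simp add: sum_incident_edges_swap sum_subtractf)
    also have "\<dots> = (\<Sum>e\<in>E. if e \<inter> S = {} then real (card (e \<inter> T)) else 0)"
      using edge by (intro sum.cong) auto
    also have "\<dots> = (\<Sum>e | e \<in> E \<and> e \<inter> S = {}. real (card (e \<inter> T)))"
      using finE by (simp add: sum.inter_filter)
    also have "\<dots> = (\<Sum>v\<in>T. real (degree {e \<in> E. e \<inter> S = {}} v))"
      using sum_incident_edges_swap[OF fin(2), of "{e \<in> E. e \<inter> S = {}}" "\<lambda>_. 1::real"] finE
      by (simp add: degree_def)
    finally have "(real a - c) * card T - (real b + c) * card S
      = (\<Sum>v\<in>T. real (degree {e \<in> E. e \<inter> S = {}} v))" .
    moreover have "real (a * card T)
        \<le> real (b * card S + (\<Sum>v\<in>T. degree {e \<in> E. e \<inter> S = {}} v))"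
      using anstee[OF ST] by (rule of_nat_mono)
    \<comment> \<open>Subtracting the identity from the criterion leaves a deficit of
      \<open>c\<close> for each vertex of \<open>S\<close> and \<open>T\<close>.\<close>
    ultimately have "c * (card S + card T) \<le> 0"
      by (simp add: algebra_simps)
    then show False
      using \<open>c > 0\<close> nonempty by (simp add: mult_le_0_iff flip: of_nat_add)
  qed
  have "real a \<le> d v \<and> d v \<le> real b" if "v \<in> V" for v
    using y0[OF that] ab' unfolding y_def defect_def
    by (auto simp: max_def min_def split: if_splits)
  then have "fractional_factor a b V E {e \<in> E. h e > 0}"
    unfolding fractional_factor_def d_def using h by blast
  then show ?thesis by blast
qed

section \<open>Degrees after deleting \<open>S\<close>, non-edges, and the arithmetic\<close>

lemma degree_le_degree_avoiding:
  assumes "simple_graph V E" "finite S" "v \<notin> S"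
  shows "degree E v \<le> degree {e \<in> E. e \<inter> S = {}} v + card S"
proof -
  have finE: "finite E" using assms(1) by (rule simple_graph_finite_edges)
  have "incident_edges E v
      \<subseteq> incident_edges {e \<in> E. e \<inter> S = {}} v \<union> (\<lambda>w. {v, w}) ` S"
  proof
    fix e assume e: "e \<in> incident_edges E v"
    then obtain u w where "e = {u, w}"
      using simple_graph_edgeE[OF assms(1)] unfolding incident_edges_def by blast
    with e assms(3) show "e \<in> incident_edges {e \<in> E. e \<inter> S = {}} v \<union> (\<lambda>w. {v, w}) ` S"
      unfolding incident_edges_def by (auto simp: insert_commute)
  qed
  then have "degree E v
      \<le> card (incident_edges {e \<in> E. e \<inter> S = {}} v \<union> (\<lambda>w. {v, w}) ` S)"
    unfolding degree_def using finE assms(2)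
    by (intro card_mono) (auto simp: incident_edges_def)
  also have "\<dots> \<le> degree {e \<in> E. e \<inter> S = {}} v + card ((\<lambda>w. {v, w}) ` S)"
    unfolding degree_def by (rule card_Un_le)
  also have "card ((\<lambda>w. {v, w}) ` S) \<le> card S"
    using assms(2) by (rule card_image_le)
  finally show ?thesis by simp
qed

text \<open>Every vertex outside \<open>S\<close> other than \<open>v\<close> is joined to
  \<open>v\<close> by an edge avoiding \<open>S\<close> or by a non-edge; the final 1 counts
  \<open>v\<close> itself.\<close>

lemma card_le_degree_avoiding_plus_complement:
  assumes "simple_graph V E" "S \<subseteq> V" "v \<in> V" "v \<notin> S"
  shows "card V \<le> degree {e \<in> E. e \<inter> S = {}} v + degree (nsets V 2 - E) v + card S + 1"
proof -
  have finV: "finite V" using assms(1) by (simp add: simple_graph_def)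
  have finE: "finite E" using assms(1) by (rule simple_graph_finite_edges)
  have finC: "finite (nsets V 2)" using finV by (rule finite_imp_finite_nsets)
  let ?f = "\<lambda>w. {v, w}" and ?W = "V - insert v S"
  have "card ?W = card (?f ` ?W)"
    by (rule card_image[symmetric]) (auto simp: inj_on_def doubleton_eq_iff)
  also have "\<dots> \<le> card (incident_edges {e \<in> E. e \<inter> S = {}} v
      \<union> incident_edges (nsets V 2 - E) v)"
  proof (rule card_mono)
    show "finite (incident_edges {e \<in> E. e \<inter> S = {}} v \<union> incident_edges (nsets V 2 - E) v)"
      using finE finC by (simp add: incident_edges_def)
    show "?f ` ?W \<subseteq> incident_edges {e \<in> E. e \<inter> S = {}} v \<union> incident_edges (nsets V 2 - E) v"
      using assms(3,4) by (auto simp: incident_edges_def nsets_def)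
  qed
  also have "\<dots> \<le> degree {e \<in> E. e \<inter> S = {}} v + degree (nsets V 2 - E) v"
    unfolding degree_def by (rule card_Un_le)
  finally have "card ?W \<le> degree {e \<in> E. e \<inter> S = {}} v + degree (nsets V 2 - E) v" .
  moreover have "card ?W = card V - (card S + 1)"
    using assms finV finite_subset[OF assms(2) finV] by (subst card_Diff_subset) auto
  ultimately show ?thesis by simp
qed

text \<open>Here \<open>D\<close> is the degree sum over \<open>T\<close> in \<open>(G - e) - S\<close> and \<open>M\<close> is the number of
  non-edges of \<open>G - e\<close>.\<close>

lemma anstee_arith:
  fixes a b n s t D M :: int
  assumes "b \<ge> a" "b \<ge> 3" "n \<ge> 7" "s \<ge> 0" "t \<ge> 0" "s + t \<le> n"
    and deg: "a * t \<le> D + s * t" "(a + 1) * t \<le> D + s * t + 2"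
    and edges: "n * t \<le> D + 2 * M + (s + 1) * t" "2 * M \<le> 2 * n - a - 2"
  shows "a * t \<le> b * s + D"
proof (rule ccontr)
  assume "\<not> ?thesis"
  then have viol: "D + b * s + 1 \<le> a * t" by simp
  consider "s = 0" | "s = 1" | "s \<ge> 2" using \<open>s \<ge> 0\<close> by linarith
  then show False
  proof cases
    case 1
    then show ?thesis using viol deg by simp
  next
    case 2
    \<comment> \<open>For \<open>s = 1\<close> the second degree bound reads
      \<open>a * t <= D + 2\<close>, while the violation gives
      \<open>D + b + 1 <= a * t\<close>.\<close>
    then show ?thesis using viol deg \<open>b \<ge> 3\<close> by (simp add: algebra_simps)
  next
    case 3
    have "s * b < s * t" using viol deg(1) by (simp add: algebra_simps)
    then have "t \<ge> b + 1" using 3 by (simp add: mult_less_cancel_left)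
    \<comment> \<open>\<open>k\<close> is what remains of the \<open>n - 1 - s\<close> possible
      neighbours outside \<open>S\<close> after \<open>a\<close> of them; it is nonnegative since
      \<open>n - s >= t >= b + 1 >= a + 1\<close>.\<close>
    define k where "k = n - 1 - s - a"
    have k: "k \<ge> 0"
      using assms \<open>t \<ge> b + 1\<close> unfolding k_def by linarith
    have "t * k + b * s + 1 \<le> 2 * M"
      using viol edges(1) unfolding k_def by (simp add: algebra_simps)
    also have "\<dots> \<le> 2 * k + 2 * s + a"
      using edges(2) unfolding k_def by simp
    finally have le: "(t - 2) * k + (b - 2) * s + 1 \<le> a"
      by (simp add: algebra_simps)
    have "(b - 2) * 2 \<le> (b - 2) * s"
      using 3 \<open>b \<ge> 3\<close> by (intro mult_left_mono) auto
    moreover have "2 * k \<le> (t - 2) * k"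
      using \<open>t \<ge> b + 1\<close> \<open>b \<ge> 3\<close> k by (intro mult_right_mono) auto
    ultimately have "2 * k + 2 * b \<le> a + 3"
      using le by (smt (verit))
    \<comment> \<open>Only the extremal case survives: with \<open>s <= 2\<close> it forces
      \<open>n = 1 + s + a <= 6\<close>, which \<open>n >= 7\<close> excludes.\<close>
    then have "k = 0" "b = 3" "a = 3"
      using assms(1,2) k by auto
    then have "s \<le> 2" using le by simp
    then show ?thesis
      using \<open>k = 0\<close> \<open>a = 3\<close> \<open>n \<ge> 7\<close> unfolding k_def by simp
  qed
qed

section \<open>The criterion in \<open>G - e\<close>\<close>

theorem theorem1p8:
  fixes V :: "'a set" and E :: "'a set set" and a b n :: nat
  assumes "1 \<le> a"
    and "b \<ge> max a 3"
    and "simple_graph V E"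
    and "card V = n"
    and "n \<ge> max (a + 2) 7"
    and "min_degree V E \<ge> a + 1"
    and "real (card E) \<ge> real ((n - 1) choose 2) + (real a + 2) / 2"
  shows "fractional_deleted_graph a b V E"
  unfolding fractional_deleted_graph_def
proof
  fix e assume "e \<in> E"
  let ?H = "E - {e}"
  let ?C = "nsets V 2 - ?H"
  have finV: "finite V" using assms(3) by (simp add: simple_graph_def)
  have finE: "finite E" using assms(3) by (rule simple_graph_finite_edges)
  have H: "simple_graph V ?H" and C: "simple_graph V ?C"
    using assms(3) by (auto simp: simple_graph_def)
  have degE: "a + 1 \<le> degree E v" if "v \<in> V" for v
    using assms(6) that finV unfolding min_degree_def by (meson Min_le finite_imageI imageI le_trans)
  \<comment> \<open>The cardinality is the indicator of \<open>v\<close> being an end of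
    \<open>e\<close>. Kept explicit, it can be bounded by 1 per vertex or by 2 over all of
    \<open>T\<close>.\<close>
  have degH: "degree E v = degree ?H v + card ({e} \<inter> {f. v \<in> f})" for v
  proof -
    have "incident_edges E v = incident_edges ?H v \<union> ({e} \<inter> {f. v \<in> f})"
      using \<open>e \<in> E\<close> by (auto simp: incident_edges_def)
    then show ?thesis
      unfolding degree_def using finE
      by (simp add: card_Un_disjoint incident_edges_def disjoint_iff)
  qed
  have card_C: "2 * int (card ?C) \<le> 2 * int n - int a - 2"
  proof -
    have sub: "?H \<subseteq> nsets V 2" using H by (simp add: simple_graph_def)
    have "card ?C = card (nsets V 2) - card ?H"
      using sub finE by (intro card_Diff_subset) auto
    moreover have "card ?H \<le> card (nsets V 2)"
      using sub finV by (intro card_mono finite_imp_finite_nsets)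
    moreover have "card ?H + 1 = card E"
      using \<open>e \<in> E\<close> finE by (metis Suc_eq_plus1 card.remove)
    moreover have "card (nsets V 2) = n choose 2"
      using assms(4) by (simp add: card_nsets)
    moreover have "n choose 2 = (n - 1 choose 2) + (n - 1)"
      using assms(5) by (cases n) (auto simp: numeral_2_eq_2)
    \<comment> \<open>The term \<open>n\<close> instead of \<open>n - 1\<close> arises because
      \<open>e\<close> itself counts as a non-edge of \<open>G - e\<close>.\<close>
    ultimately have "card ?C + card E = (n - 1 choose 2) + n"
      using assms(5) by linarith
    then have "real (card ?C) + real (card E) = real (n - 1 choose 2) + real n"
      by (metis of_nat_add)
    then have "2 * real (card ?C) + real a + 2 \<le> 2 * real n"
      using assms(7) by (simp add: field_simps)
    then show ?thesis by linarith
  qed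
  show "\<exists>F. fractional_factor a b V ?H F"
  proof (rule fractional_factor_if_anstee[OF H])
    show "a \<le> b" using assms(2) by simp
    fix S T assume ST: "S \<subseteq> V" "T \<subseteq> V" "S \<inter> T = {}"
    have fin: "finite S" "finite T" using ST finV finite_subset by blast+
    let ?d = "degree {f \<in> ?H. f \<inter> S = {}}"
    define D where "D = (\<Sum>v\<in>T. ?d v)"
    have degHS: "degree ?H v \<le> ?d v + card S" if "v \<in> T" for v
      using degree_le_degree_avoiding[OF H fin(1)] ST that by blast
    have one: "card ({e} \<inter> {f. v \<in> f}) \<le> 1" for v
      by (metis card_mono card.empty card_insert_disjoint empty_iff finite.intros One_nat_def inf_le1)
    have "a * card T = (\<Sum>v\<in>T. a)" by simp
    also have "\<dots> \<le> (\<Sum>v\<in>T. ?d v + card S)"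
    proof (rule sum_mono)
      fix v assume "v \<in> T"
      then show "a \<le> ?d v + card S"
        using degHS[of v] degE[of v] degH[of v] one[of v] ST by force
    qed
    finally have deg1: "a * card T \<le> D + card S * card T"
      by (simp add: sum.distrib D_def mult.commute)
    \<comment> \<open>Viewing \<open>{e}\<close> as a graph with one edge, its degree sum over
      \<open>T\<close> is at most 2.\<close>
    have two: "(\<Sum>v\<in>T. card ({e} \<inter> {f. v \<in> f})) \<le> 2"
    proof -
      have "(\<Sum>v\<in>T. card ({e} \<inter> {f. v \<in> f})) = (\<Sum>v\<in>T. degree {e} v)"
        by (intro sum.cong refl arg_cong[of _ _ card]) (auto simp: degree_def incident_edges_def Int_def)
      also have "\<dots> \<le> 2"
        using sum_degree_le[of V "{e}" T] assms(3) \<open>e \<in> E\<close> fin by (auto simp: simple_graph_def)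
      finally show ?thesis .
    qed
    have "(a + 1) * card T = (\<Sum>v\<in>T. a + 1)" by simp
    also have "\<dots> \<le> (\<Sum>v\<in>T. ?d v + card S + card ({e} \<inter> {f. v \<in> f}))"
    proof (rule sum_mono)
      fix v assume "v \<in> T"
      then show "a + 1 \<le> ?d v + card S + card ({e} \<inter> {f. v \<in> f})"
        using degHS[of v] degE[of v] degH[of v] ST by force
    qed
    also have "\<dots> \<le> D + card S * card T + 2"
      using two by (simp add: sum.distrib D_def mult.commute)
    finally have deg2: "(a + 1) * card T \<le> D + card S * card T + 2" .
    have "n * card T = (\<Sum>v\<in>T. n)" by simp
    also have "\<dots> \<le> (\<Sum>v\<in>T. ?d v + degree ?C v + (card S + 1))"
    proof (rule sum_mono)
      fix v assume "v \<in> T"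
      then have "v \<in> V" "v \<notin> S" using ST by auto
      from card_le_degree_avoiding_plus_complement[OF H ST(1) this] assms(4)
      show "n \<le> ?d v + degree ?C v + (card S + 1)" by linarith
    qed
    also have "\<dots> = D + (\<Sum>v\<in>T. degree ?C v) + (card S + 1) * card T"
      by (simp only: sum.distrib D_def sum_constant of_nat_id) (simp add: algebra_simps)
    \<comment> \<open>Each non-edge is counted at most twice, once for each end in
      \<open>T\<close>.\<close>
    also have "\<dots> \<le> D + 2 * card ?C + (card S + 1) * card T"
      using sum_degree_le[OF C fin(2)] by simp
    finally have edges: "n * card T \<le> D + 2 * card ?C + (card S + 1) * card T" .
    have "card S + card T \<le> n"
      using card_mono[OF finV, of "S \<union> T"] ST fin assms(4) by (simp add: card_Un_disjoint)
    then have st: "int (card S) + int (card T) \<le> int n" by linarith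
    have "int a * int (card T) \<le> int b * int (card S) + int D"
    proof (rule anstee_arith[OF _ _ _ _ _ st _ _ _ card_C])
      show "int a * int (card T) \<le> int D + int (card S) * int (card T)"
        using of_nat_mono[OF deg1, where 'a = int] by (simp only: of_nat_add of_nat_mult)
      show "(int a + 1) * int (card T) \<le> int D + int (card S) * int (card T) + 2"
        using of_nat_mono[OF deg2, where 'a = int]
        by (simp only: of_nat_add of_nat_mult of_nat_1 of_nat_numeral)
      show "int n * int (card T)
          \<le> int D + 2 * int (card ?C) + (int (card S) + 1) * int (card T)"
        using of_nat_mono[OF edges, where 'a = int]
        by (simp only: of_nat_add of_nat_mult of_nat_1 of_nat_numeral)
    qed (use assms(2,5) in auto)
    then have "int (a * card T) \<le> int (b * card S + D)" by simp
    then show "a * card T \<le> b * card S + (\<Sum>v\<in>T. ?d v)"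
      unfolding D_def by (simp only: of_nat_le_iff)
  qed
qed

end
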